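(* Let $P=Q_1\oplus\cdots\oplus Q_k$ be a ladder on $[n]$, where each $Q_i$ is an antichain $\{a_i\}$ or $\{a_i,b_i\}$. Then the promotion transition matrix $M^P$ is diagonalizable. In particular, the eigenvalues of $M^P$ are exactly the scalars $c^v$ that can be obtained using the following procedure, with corresponding eigenfunctions (right eigenvectors) $v$. Set $c_0=0$. For $i=1,\dots,k$: - if $|Q_i|=1$, set $v_i=(1)$ and $c_i=c_{i-1}+x_{a_i}$; - if $|Q_i|=2$, choose either $v_i=\begin{pmatrix}1\\ 1\end{pmatrix}$ and $c_i=c_{i-1}+x_{a_i}+x_{b_i}$, or $v_i=\begin{pmatrix}-x_{a_i}\\ x_{b_i}\end{pmatrix}-c_{i-1}\begin{pmatrix}1\\ -1\end{pmatrix}$ and $c_i=-c_{i-1}$. Finally set $v=v_1\otimes\cdots\otimes v_k$ and $c^v=c_k$.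
   Context: The ordinal sum $P\oplus Q$ of posets is the disjoint union with the relations of $P$, of $Q$, and $x\prec y$ for all $x\in P$, $y\in Q$. A ladder of rank $k$ is a poset $Q_1\oplus\cdots\oplus Q_k$ where each $Q_i$ is an antichain of size 1 or 2. A linear extension of a poset $P$ on $[n]=\{1,\dots,n\}$ is a word $\pi=\pi_1\cdots\pi_n$ listing each element of $P$ once, such that $\pi_i\prec\pi_j$ implies $i<j$; $\mathcal L(P)$ is the set of linear extensions. For $1\le i\le n-1$, $\tau_i\pi$ is obtained from $\pi$ by interchanging $\pi_i$ and $\pi_{i+1}$ if these are incomparable in $P$, and $\tau_i\pi=\pi$ otherwise. For $1\le i\le n$ the extended promotion operator is $\partial_i=\tau_{n-1}\cdots\tau_{i+1}\tau_i$ ($\tau_i$ applied first; $\partial_n$ is the identity). Let $x_1,\dots,x_n\ge 0$ with $\sum_{i=1}^n x_i=1$. The promotion Markov chain on $\mathcal L(P)$ moves from $\pi$ to $\partial_i\pi$ with probability $x_{\pi_i}$, for $i=1,\dots,n$. Its row stochastic transition matrix is $M^P$: rows and columns are indexed by $\mathcal L(P)$, and the $(\pi,\pi')$ entry is $\sum x_{\pi_i}$, the sum over all $i$ with $\partial_i\pi=\pi'$. Ordering of $\mathcal L(P)$: a linear extension of the ladder is a concatenation of orderings of the levels $Q_1,\dots,Q_k$; they are ordered lexicographically by levels $1,\dots,k$, where at a level of size two the ordering $a_ib_i$ comes before $b_ia_i$. Tensor (Kronecker) products of vectors are indexed accordingly.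
   Formalization: Diagonalizability and "v is an eigenvector" are claimed only if x_{a_i}+x_{b_i}+2c_{i-1} is nonzero at each two-element level in every run; without this they can fail, e.g. {1}⊕{2,3}⊕{4,5}, x=(1/5,1/5,1/5,3/10,1/10). The eigenvalues and M v = c^v v hold for all x. *)

theory Defs
  imports Complex_Main "Jordan_Normal_Form.Char_Poly"
begin

(* A finite poset is given by its reflexive order relation r; its ground set is Field r. *)

definition ordinal_sum :: "'a rel \<Rightarrow> 'a rel \<Rightarrow> 'a rel" where
  "ordinal_sum r s = r \<union> s \<union> Field r \<times> Field s"

(* Words are 0-indexed lists, so the i-th letter of w (1 \<le> i \<le> n) is w ! (i - 1). *)

definition linear_extensions :: "'a rel \<Rightarrow> 'a list set" where
  "linear_extensions r = {w. distinct w \<and> set w = Field r \<and>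
     (\<forall>i<length w. \<forall>j<length w. (w ! i, w ! j) \<in> r \<and> w ! i \<noteq> w ! j \<longrightarrow> i < j)}"

definition tau :: "'a rel \<Rightarrow> nat \<Rightarrow> 'a list \<Rightarrow> 'a list" where
  "tau r i w =
     (let a = w ! (i - 1); b = w ! i
      in if (a, b) \<notin> r \<and> (b, a) \<notin> r then w[i - 1 := b, i := a] else w)"

(* fold applies tau r i first and tau r (length w - 1) last. *)
definition promotion :: "'a rel \<Rightarrow> nat \<Rightarrow> 'a list \<Rightarrow> 'a list" where
  "promotion r i w = fold (tau r) [i..<length w] w"

(* The list es enumerates the linear extensions; it fixes the order of rows and columns. *)
definition promotion_matrix ::
    "'a rel \<Rightarrow> ('a \<Rightarrow> real) \<Rightarrow> 'a list list \<Rightarrow> real mat" where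
  "promotion_matrix r x es = mat (length es) (length es) (\<lambda>(p, q).
     \<Sum>i\<in>{i \<in> {1..length (es ! p)}. promotion r i (es ! p) = es ! q}. x (es ! p ! (i - 1)))"

(* A ladder is given by the list of its levels, each level being [a] or [a, b]. *)

definition ladder_levels :: "nat \<Rightarrow> nat list list \<Rightarrow> bool" where
  "ladder_levels n Qs \<longleftrightarrow> (\<forall>Q\<in>set Qs. length Q = 1 \<or> length Q = 2) \<and>
     distinct (concat Qs) \<and> set (concat Qs) = {1..n}"

definition ladder :: "'a list list \<Rightarrow> 'a rel" where
  "ladder Qs = foldr (\<lambda>Q. ordinal_sum (Id_on (set Q))) Qs {}"

fun level_orderings :: "'a list \<Rightarrow> 'a list list" where
  "level_orderings [a] = [[a]]"
| "level_orderings [a, b] = [[a, b], [b, a]]"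
| "level_orderings _ = []"

fun ladder_extensions :: "'a list list \<Rightarrow> 'a list list" where
  "ladder_extensions [] = [[]]"
| "ladder_extensions (Q # Qs) = [p @ w. p \<leftarrow> level_orderings Q, w \<leftarrow> ladder_extensions Qs]"

definition kron_vec :: "real vec \<Rightarrow> real vec \<Rightarrow> real vec" where
  "kron_vec u w = vec (dim_vec u * dim_vec w)
     (\<lambda>i. u $ (i div dim_vec w) * w $ (i mod dim_vec w))"

(* The possible pairs (c_i, v_i) at a level, given c = c_{i-1}. *)
fun level_choices :: "('a \<Rightarrow> real) \<Rightarrow> real \<Rightarrow> 'a list \<Rightarrow> (real \<times> real vec) list" where
  "level_choices x c [a] = [(c + x a, vec_of_list [1])]"
| "level_choices x c [a, b] =
     [(c + x a + x b, vec_of_list [1, 1]),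
      (- c, vec_of_list [- x a, x b] - c \<cdot>\<^sub>v vec_of_list [1, - 1])]"
| "level_choices x c _ = []"

(* All pairs (c^v, v), one for each run of the procedure, where c is the initial scalar. *)
fun ladder_eigenpairs ::
    "('a \<Rightarrow> real) \<Rightarrow> real \<Rightarrow> 'a list list \<Rightarrow> (real \<times> real vec) list" where
  "ladder_eigenpairs x c [] = [(c, vec_of_list [1])]"
| "ladder_eigenpairs x c (Q # Qs) =
     [(e, kron_vec v w). (d, v) \<leftarrow> level_choices x c Q, (e, w) \<leftarrow> ladder_eigenpairs x d Qs]"

(* The two choices of v_i at a level {a, b} have determinant x_a + x_b + 2 c_{i-1}. Genericity
   asks that they be linearly independent in every run of the procedure. As c_{i-1} is a linear
   form in the weights of the lower levels, this excludes finitely many hyperplanes of weights.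
   Diagonalizability can fail on them: for [[1], [2, 3], [4, 5]] and the weights
   1/5, 1/5, 1/5, 3/10, 1/10, the eigenvalue 1/5 has algebraic multiplicity 2 and geometric
   multiplicity 1. *)
fun generic_weights :: "('a \<Rightarrow> real) \<Rightarrow> real \<Rightarrow> 'a list list \<Rightarrow> bool" where
  "generic_weights x c [] \<longleftrightarrow> True"
| "generic_weights x c (Q # Qs) \<longleftrightarrow>
     (length Q = 2 \<longrightarrow> x (Q ! 0) + x (Q ! 1) + 2 * c \<noteq> 0) \<and>
     (\<forall>(d, v)\<in>set (level_choices x c Q). generic_weights x d Qs)"

definition diagonalizable :: "real mat \<Rightarrow> bool" where
  "diagonalizable A \<longleftrightarrow> (\<exists>D. diagonal_mat D \<and> similar_mat A D)"

lemma Field_ordinal_sum: "Field (ordinal_sum r s) = Field r \<union> Field s"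
  by (auto simp: ordinal_sum_def Field_def)

lemma Field_Id_on: "Field (Id_on A) = A"
  by (auto simp: Field_def)

lemma Field_ladder: "Field (ladder Qs) = set (concat Qs)"
  by (induction Qs) (auto simp: ladder_def Field_ordinal_sum Field_Id_on)

lemma Partial_order_ordinal_sum:
  assumes r: "Partial_order r" and s: "Partial_order s" and disj: "Field r \<inter> Field s = {}"
  shows "Partial_order (ordinal_sum r s)"
proof -
  have F: "a \<in> Field r \<and> b \<in> Field r" if "(a, b) \<in> r" for a b
    using that by (auto simp: Field_def)
  have G: "a \<in> Field s \<and> b \<in> Field s" if "(a, b) \<in> s" for a b
    using that by (auto simp: Field_def)
  have ref: "Refl (ordinal_sum r s)"
    using r s unfolding partial_order_on_def preorder_on_def refl_on_def Field_ordinal_sum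
    by (auto simp: ordinal_sum_def)
  have anti: "antisym (ordinal_sum r s)"
    using r s disj F G unfolding partial_order_on_def antisym_def ordinal_sum_def by blast
  have tr: "trans (ordinal_sum r s)"
  proof (rule transI)
    fix a b c assume ab: "(a, b) \<in> ordinal_sum r s" and bc: "(b, c) \<in> ordinal_sum r s"
    have tr: "trans r" "trans s" using r s by (auto simp: partial_order_on_def preorder_on_def)
    show "(a, c) \<in> ordinal_sum r s"
      using ab bc disj F G tr unfolding ordinal_sum_def by (blast dest: transD)
  qed
  have sub: "ordinal_sum r s \<subseteq> Field (ordinal_sum r s) \<times> Field (ordinal_sum r s)"
    by (auto simp: Field_def)
  show ?thesis
    unfolding partial_order_on_def preorder_on_def using ref anti tr sub by blast
qed

lemma Partial_order_ladder: "distinct (concat Qs) \<Longrightarrow> Partial_order (ladder Qs)"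
proof (induction Qs)
  case Nil
  then show ?case
    by (simp add: ladder_def partial_order_on_def preorder_on_def refl_on_def)
next
  case (Cons Q Qs)
  have "Partial_order (Id_on (set Q))"
    by (auto simp: partial_order_on_def preorder_on_def refl_on_def Field_Id_on antisym_def
        trans_def)
  moreover have "ladder (Q # Qs) = ordinal_sum (Id_on (set Q)) (ladder Qs)"
    by (simp add: ladder_def)
  moreover have "Field (Id_on (set Q)) \<inter> Field (ladder Qs) = {}"
    using Cons.prems by (auto simp: Field_Id_on Field_ladder)
  ultimately show ?case
    using Cons by (simp add: Partial_order_ordinal_sum)
qed

lemma linear_extensions_sorted_wrt:
  "w \<in> linear_extensions r \<longleftrightarrow>
     distinct w \<and> set w = Field r \<and> sorted_wrt (\<lambda>a b. (b, a) \<notin> r) w"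
proof (cases "distinct w")
  case True
  have "(\<forall>i<length w. \<forall>j<length w. (w ! i, w ! j) \<in> r \<and> w ! i \<noteq> w ! j \<longrightarrow> i < j) \<longleftrightarrow>
      sorted_wrt (\<lambda>a b. (b, a) \<notin> r) w" (is "?L \<longleftrightarrow> ?R")
  proof
    assume L: ?L
    show ?R unfolding sorted_wrt_iff_nth_less
    proof (intro allI impI notI)
      fix i j assume ij: "i < j" "j < length w" "(w ! j, w ! i) \<in> r"
      have "w ! j \<noteq> w ! i" using ij True by (simp add: nth_eq_iff_index_eq)
      then have "j < i" using L ij by auto
      then show False using ij by simp
    qed
  next
    assume R: ?R
    show ?L
    proof (intro allI impI)
      fix i j assume ij: "i < length w" "j < length w" "(w ! i, w ! j) \<in> r \<and> w ! i \<noteq> w ! j"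
      have "\<not> j < i" using R ij unfolding sorted_wrt_iff_nth_less by blast
      moreover have "i \<noteq> j" using ij by auto
      ultimately show "i < j" by simp
    qed
  qed
  then show ?thesis by (simp add: linear_extensions_def)
qed (simp add: linear_extensions_def)

lemma linear_extensions_ordinal_sum:
  assumes disj: "Field r \<inter> Field s = {}"
  shows "linear_extensions (ordinal_sum r s) =
    {p @ w | p w. p \<in> linear_extensions r \<and> w \<in> linear_extensions s}"
proof (intro equalityI subsetI)
  have F: "a \<in> Field r \<and> b \<in> Field r" if "(a, b) \<in> r" for a b
    using that by (auto simp: Field_def)
  have G: "a \<in> Field s \<and> b \<in> Field s" if "(a, b) \<in> s" for a b
    using that by (auto simp: Field_def)
  have on_r: "(a, b) \<in> ordinal_sum r s \<longleftrightarrow> (a, b) \<in> r" if "b \<in> Field r" for a b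
    using that disj F G unfolding ordinal_sum_def by blast
  have on_s: "(a, b) \<in> ordinal_sum r s \<longleftrightarrow> (a, b) \<in> s" if "a \<in> Field s" for a b
    using that disj F G unfolding ordinal_sum_def by blast
  {
    fix u assume u: "u \<in> linear_extensions (ordinal_sum r s)"
    define p where "p = takeWhile (\<lambda>a. a \<in> Field r) u"
    define w where "w = dropWhile (\<lambda>a. a \<in> Field r) u"
    have upw: "u = p @ w" by (simp add: p_def w_def)
    have p: "set p \<subseteq> Field r" by (auto simp: p_def dest: set_takeWhileD)
    have su: "set u = Field r \<union> Field s" and du: "distinct u"
      and so: "sorted_wrt (\<lambda>a b. (b, a) \<notin> ordinal_sum r s) u"
      using u by (auto simp: linear_extensions_sorted_wrt Field_ordinal_sum)
    have w: "set w \<inter> Field r = {}"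
    proof (cases w)
      case (Cons h t)
      have hr: "h \<notin> Field r"
        using Cons hd_dropWhile[of "\<lambda>a. a \<in> Field r" u] by (simp add: w_def)
      then have hs: "h \<in> Field s" using su upw Cons by auto
      have "b \<notin> Field r" if "b \<in> set t" for b
        using so upw Cons that hs by (auto simp: sorted_wrt_append ordinal_sum_def)
      then show ?thesis using hr Cons by auto
    qed simp
    have sp: "set p = Field r" and sw: "set w = Field s" using su upw p w disj by auto
    have "sorted_wrt (\<lambda>a b. (b, a) \<notin> r) p"
      by (rule sorted_wrt_mono_rel[of p "\<lambda>a b. (b, a) \<notin> ordinal_sum r s"])
        (use so upw in \<open>auto simp: sorted_wrt_append ordinal_sum_def\<close>)
    moreover have "sorted_wrt (\<lambda>a b. (b, a) \<notin> s) w"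
      by (rule sorted_wrt_mono_rel[of w "\<lambda>a b. (b, a) \<notin> ordinal_sum r s"])
        (use so upw in \<open>auto simp: sorted_wrt_append ordinal_sum_def\<close>)
    ultimately show "u \<in> {p @ w | p w. p \<in> linear_extensions r \<and> w \<in> linear_extensions s}"
      using sp sw du upw by (auto simp: linear_extensions_sorted_wrt)
  next
    fix u assume "u \<in> {p @ w | p w. p \<in> linear_extensions r \<and> w \<in> linear_extensions s}"
    then obtain p w where u: "u = p @ w"
      and p: "distinct p" "set p = Field r" "sorted_wrt (\<lambda>a b. (b, a) \<notin> r) p"
      and w: "distinct w" "set w = Field s" "sorted_wrt (\<lambda>a b. (b, a) \<notin> s) w"
      by (auto simp: linear_extensions_sorted_wrt)
    have "sorted_wrt (\<lambda>a b. (b, a) \<notin> ordinal_sum r s) p"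
      by (rule sorted_wrt_mono_rel[OF _ p(3)]) (use p(2) on_r in auto)
    moreover have "sorted_wrt (\<lambda>a b. (b, a) \<notin> ordinal_sum r s) w"
      by (rule sorted_wrt_mono_rel[OF _ w(3)]) (use w(2) on_s in auto)
    moreover have "(b, a) \<notin> ordinal_sum r s" if "a \<in> set p" "b \<in> set w" for a b
      using that p(2) w(2) on_s G disj by blast
    ultimately show "u \<in> linear_extensions (ordinal_sum r s)"
      using p w u disj
      by (auto simp: linear_extensions_sorted_wrt Field_ordinal_sum sorted_wrt_append)
  }
qed

lemma linear_extensions_Id_on: "linear_extensions (Id_on A) = {w. distinct w \<and> set w = A}"
  by (auto simp: linear_extensions_def Field_Id_on)

lemma set_level_orderings:
  assumes "length Q = 1 \<or> length Q = 2" "distinct Q"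
  shows "set (level_orderings Q) = linear_extensions (Id_on (set Q)) \<and>
    distinct (level_orderings Q) \<and> (\<forall>p\<in>set (level_orderings Q). length p = length Q)"
  using assms(1)
proof
  assume "length Q = 1"
  then obtain a where Q: "Q = [a]" by (cases Q) auto
  have "p = [a]" if "distinct p" "set p = {a}" for p
  proof -
    have "length p = 1" using that distinct_card[of p] by simp
    then obtain c where "p = [c]" by (cases p) auto
    then show ?thesis using that(2) by simp
  qed
  then have "{p. distinct p \<and> set p = {a}} = {[a]}" by fastforce
  then show ?thesis by (simp add: Q linear_extensions_Id_on)
next
  assume "length Q = 2"
  then obtain a b where Q: "Q = [a, b]" by (cases Q; cases "tl Q") auto
  then have ab: "a \<noteq> b" using assms(2) by simp
  have two: "p = [a, b] \<or> p = [b, a]" if "distinct p" "set p = {a, b}" for p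
  proof -
    have "length p = 2" using that ab distinct_card[of p] by simp
    then obtain c d where "p = [c, d]" by (cases p; cases "tl p") auto
    then show ?thesis using that(2) by (simp add: doubleton_eq_iff)
  qed
  have "{p. distinct p \<and> set p = {a, b}} = {[a, b], [b, a]}"
  proof (intro equalityI subsetI)
    fix p assume "p \<in> {p. distinct p \<and> set p = {a, b}}"
    then show "p \<in> {[a, b], [b, a]}" using two[of p] by simp
  next
    fix p assume "p \<in> {[a, b], [b, a]}"
    then show "p \<in> {p. distinct p \<and> set p = {a, b}}" using ab by auto
  qed
  then show ?thesis using ab by (simp add: Q linear_extensions_Id_on)
qed

lemma ladder_extensions_enumerate:
  assumes "\<forall>Q\<in>set Qs. length Q = 1 \<or> length Q = 2" "distinct (concat Qs)"
  shows "set (ladder_extensions Qs) = linear_extensions (ladder Qs) \<and>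
    distinct (ladder_extensions Qs)"
  using assms
proof (induction Qs)
  case Nil
  then show ?case by (auto simp: ladder_def linear_extensions_def)
next
  case (Cons Q Qs)
  have Q: "length Q = 1 \<or> length Q = 2" "distinct Q" using Cons.prems by auto
  note lo = set_level_orderings[OF Q]
  have IH: "set (ladder_extensions Qs) = linear_extensions (ladder Qs)"
    "distinct (ladder_extensions Qs)" using Cons by auto
  have lad: "ladder (Q # Qs) = ordinal_sum (Id_on (set Q)) (ladder Qs)"
    by (simp add: ladder_def)
  have disj: "Field (Id_on (set Q)) \<inter> Field (ladder Qs) = {}"
    using Cons.prems by (auto simp: Field_Id_on Field_ladder)
  have S: "set (ladder_extensions (Q # Qs)) = linear_extensions (ladder (Q # Qs))"
    unfolding lad linear_extensions_ordinal_sum[OF disj] using lo IH(1) by auto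
  have D: "distinct [p @ w. p \<leftarrow> ps, w \<leftarrow> ws]"
    if "distinct ps" "distinct ws" "\<forall>p\<in>set ps. length p = m" for ps ws :: "'a list list" and m
    using that by (induction ps) (auto simp: distinct_map inj_on_def)
  show ?case
    using S D[of "level_orderings Q" "ladder_extensions Qs" "length Q"] lo IH(2) by simp
qed

end

theory Submission
  imports Defs
begin

text \<open>
  Let \<open>T\<close> be the matrix of the first promotion operator. A promotion starting in the first level
  never carries a letter across the boundary to the later levels, but it does trigger the first
  promotion operator there. Hence removing levels from the bottom turns \<open>M\<close> into matrices of the
  form \<open>M + c T\<close>, with \<open>c\<close> the scalar of the procedure: a level \<open>{a}\<close> replaces \<open>c\<close> by
  \<open>c + x a\<close>, and a level \<open>{a, b}\<close> yields the block matrix with rows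
  \<open>(M + x b T, (c + x a) T)\<close> and \<open>((c + x b) T, M + x a T)\<close>, where \<open>M\<close> and \<open>T\<close> belong to the
  remaining ladder. Both block rows sum to \<open>M + (c + x a + x b) T\<close>, so the block matrix is similar
  to a block triangular one with diagonal blocks \<open>M + (c + x a + x b) T\<close> and \<open>M - c T\<close>. This
  gives the characteristic polynomial for all weights; genericity is needed only for the
  determinant of the matrix of eigenvectors, which is a product of powers of the
  \<open>x a + x b + 2 c\<close>.
\<close>

section \<open>Block matrices: characteristic polynomials and determinants\<close>

lemma char_poly_four_block_mat_lower_left_zero:
  fixes A :: "'a :: idom mat"
  assumes A: "A \<in> carrier_mat n n" and B: "B \<in> carrier_mat n m" and D: "D \<in> carrier_mat m m"
  shows "char_poly (four_block_mat A B (0\<^sub>m m n) D) = char_poly A * char_poly D"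
proof -
  let ?F = "four_block_mat A B (0\<^sub>m m n) D"
  have "char_poly_matrix ?F = four_block_mat (char_poly_matrix A) (map_mat (\<lambda>a. [:- a:]) B)
      (0\<^sub>m m n) (char_poly_matrix D)"
    by (rule eq_matI, insert A B D, auto simp: char_poly_matrix_def one_poly_def)
  then show ?thesis
    unfolding char_poly_def
    by (simp, intro det_four_block_mat_lower_left_zero) (use A B D in \<open>auto simp: char_poly_matrix_def\<close>)
qed

text \<open>The vectors \<open>(u, u)\<close> form an invariant subspace, on which the block matrix
  acts as \<open>A + B\<close>; modulo this subspace it acts as \<open>D - B\<close>. The matrix
  \<open>?P\<close>, with inverse \<open>?Q\<close>, passes to a basis adapted to the
  subspace.\<close>

lemma char_poly_four_block_mat_row_sums:
  fixes A :: "'a :: idom mat"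
  assumes A: "A \<in> carrier_mat n n" and B: "B \<in> carrier_mat n n"
    and C: "C \<in> carrier_mat n n" and D: "D \<in> carrier_mat n n"
    and eq: "C + D = A + B"
  shows "char_poly (four_block_mat A B C D) = char_poly (A + B) * char_poly (D - B)"
proof -
  let ?F = "four_block_mat A B C D"
  let ?G = "four_block_mat (A + B) B (0\<^sub>m n n) (D - B)"
  let ?P = "four_block_mat (1\<^sub>m n) (0\<^sub>m n n) (1\<^sub>m n) (1\<^sub>m n) :: 'a mat"
  let ?Q = "four_block_mat (1\<^sub>m n) (0\<^sub>m n n) (- 1\<^sub>m n) (1\<^sub>m n) :: 'a mat"
  \<comment> \<open>Eliminating \<open>C\<close> leaves an identity in \<open>A\<close>,
    \<open>B\<close> and \<open>D\<close> when the product with \<open>?Q\<close> is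
    computed.\<close>
  have C': "C = (A + B) - D"
    using A B C D unfolding eq[symmetric] by (intro eq_matI) auto
  have one: "- 1\<^sub>m n + 1\<^sub>m n = (0\<^sub>m n n :: 'a mat)" "1\<^sub>m n + - 1\<^sub>m n = (0\<^sub>m n n :: 'a mat)"
    "- 0\<^sub>m n n = (0\<^sub>m n n :: 'a mat)"
    by (intro eq_matI; auto)+
  have PQ: "?P * ?Q = 1\<^sub>m (n + n)" and QP: "?Q * ?P = 1\<^sub>m (n + n)"
    by (subst mult_four_block_mat[of _ n n _ n _ n _ _ n _ n]; auto simp: one)+
  have "?P * ?G = four_block_mat (A + B) B (A + B) D"
    using A B C D by (subst mult_four_block_mat[of _ n n _ n _ n _ _ n _ n])
      (auto intro!: cong_four_block_mat eq_matI)
  moreover have "four_block_mat (A + B) B (A + B) D * ?Q = ?F"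
    unfolding C'
    using A B C D by (subst mult_four_block_mat[of _ n n _ n _ n _ _ n _ n])
      (auto simp: mult_minus_distrib_mat intro!: cong_four_block_mat eq_matI)
  ultimately have "?F = ?P * ?G * ?Q" by simp
  then have "similar_mat ?F ?G"
    using A B C D PQ QP by (intro similar_matI[of _ _ ?P ?Q "n + n"]) auto
  then have "char_poly ?F = char_poly ?G" by (rule char_poly_similar)
  also have "\<dots> = char_poly (A + B) * char_poly (D - B)"
    using A B C D by (intro char_poly_four_block_mat_lower_left_zero) auto
  finally show ?thesis .
qed

text \<open>Subtracting the first block row from the second clears the lower left block. The matrix
  of eigenvectors has this shape at a pair level, where the first choice yields vectors
  \<open>(u, u)\<close>.\<close>

lemma det_four_block_mat_same_left:
  fixes A :: "'a :: idom mat"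
  assumes A: "A \<in> carrier_mat n n" and B: "B \<in> carrier_mat n n" and D: "D \<in> carrier_mat n n"
  shows "det (four_block_mat A B A D) = det A * det (D - B)"
proof -
  let ?Q = "four_block_mat (1\<^sub>m n) (0\<^sub>m n n) (- 1\<^sub>m n) (1\<^sub>m n) :: 'a mat"
  let ?F = "four_block_mat A B A D"
  have "?Q * ?F = four_block_mat A B (0\<^sub>m n n) (D - B)"
    using A B D by (subst mult_four_block_mat[of _ n n _ n _ n _ _ n _ n])
      (auto intro!: cong_four_block_mat eq_matI)
  then have "det (?Q * ?F) = det A * det (D - B)"
    using A B D by (simp only:) (rule det_four_block_mat_lower_left_zero[of _ n _ n], auto)
  moreover have "det (?Q * ?F) = det ?Q * det ?F"
    by (rule det_mult[of _ "n + n"]) (use A B D in auto)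
  moreover have "det ?Q = 1"
    by (subst det_four_block_mat_upper_right_zero[of _ n _ n]) auto
  ultimately show ?thesis by simp
qed

section \<open>Diagonalization by a basis of eigenvectors\<close>

lemma det_nonzero_inverse:
  fixes A :: "'a :: field mat"
  assumes A: "A \<in> carrier_mat n n" and "det A \<noteq> 0"
  obtains B where "B \<in> carrier_mat n n" "A * B = 1\<^sub>m n" "B * A = 1\<^sub>m n"
proof -
  have "A \<in> Units (ring_mat TYPE('a) n ())"
    using assms by (rule det_non_zero_imp_unit)
  then show thesis
    using that by (auto simp: Units_def ring_mat_def)
qed

text \<open>With the vectors as columns of \<open>?V\<close> and the scalars on the diagonal of
  \<open>?D\<close>, the eigenvalue equations read \<open>M * ?V = ?V * ?D\<close>. The nonzero
  determinant provides the inverse of \<open>?V\<close>.\<close>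

lemma eigenvectors_diagonalize:
  assumes M: "M \<in> carrier_mat n n"
    and len: "length ps = n"
    and ps: "\<forall>(c, v)\<in>set ps. v \<in> carrier_vec n \<and> M *\<^sub>v v = c \<cdot>\<^sub>v v"
    and det: "det (mat_of_cols n (map snd ps)) \<noteq> 0"
  shows "diagonalizable M \<and> (\<forall>(c, v)\<in>set ps. eigenvector M v c)
    \<and> invertible_mat (mat_of_cols n (map snd ps))"
proof -
  let ?V = "mat_of_cols n (map snd ps)"
  let ?D = "mat_diag n (\<lambda>j. fst (ps ! j))"
  have V: "?V \<in> carrier_mat n n" using len by (simp add: mat_of_cols_def)
  obtain W where W: "W \<in> carrier_mat n n" and VW: "?V * W = 1\<^sub>m n" and WV: "W * ?V = 1\<^sub>m n"
    using det_nonzero_inverse[OF V det] by blast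
  have nth: "snd (ps ! j) \<in> carrier_vec n \<and> M *\<^sub>v snd (ps ! j) = fst (ps ! j) \<cdot>\<^sub>v snd (ps ! j)"
    if "j < n" for j
    using ps that len nth_mem[of j ps] by (auto simp: case_prod_beta)
  have col: "col ?V j = snd (ps ! j)" if "j < n" for j
    using that len nth[OF that] by (intro eq_vecI) (auto simp: mat_of_cols_index)
  have "M * ?V = ?V * ?D"
  proof (rule eq_matI)
    fix i j assume "i < dim_row (?V * ?D)" "j < dim_col (?V * ?D)"
    then have ij: "i < n" "j < n" by (auto simp: mat_diag_def)
    have "(M * ?V) $$ (i, j) = (M *\<^sub>v snd (ps ! j)) $ i"
      using ij M V len by (simp add: col[OF ij(2)])
    also have "\<dots> = fst (ps ! j) * snd (ps ! j) $ i"
      using nth[of j] ij by auto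
    finally show "(M * ?V) $$ (i, j) = (?V * ?D) $$ (i, j)"
      using ij len by (subst mat_diag_mult_right[OF V]) (simp add: mat_of_cols_index)
  qed (use M V in \<open>auto simp: mat_diag_def\<close>)
  moreover have D: "?D \<in> carrier_mat n n" by simp
  moreover have "M = M * ?V * W" using M V W VW by simp
  ultimately have "M = ?V * ?D * W" by metis
  moreover have "{M, ?D, ?V, W} \<subseteq> carrier_mat n n" using M V W D by simp
  ultimately have "similar_mat M ?D" using VW WV by (blast intro: similar_matI)
  moreover have "diagonal_mat ?D" by (simp add: diagonal_mat_def mat_diag_def)
  ultimately have "diagonalizable M" unfolding diagonalizable_def by blast
  moreover have "invertible_mat ?V"
    unfolding invertible_mat_def inverts_mat_def using V W VW WV by auto
  moreover have "eigenvector M v c" if cv: "(c, v) \<in> set ps" for c v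
  proof -
    have v: "v \<in> carrier_vec n" "M *\<^sub>v v = c \<cdot>\<^sub>v v" using ps cv by auto
    obtain j where j: "j < n" "ps ! j = (c, v)" using cv len by (metis in_set_conv_nth)
    \<comment> \<open>A zero column of \<open>?V\<close> would put a zero on the diagonal of
      \<open>W * ?V\<close>, which is the identity.\<close>
    have "v \<noteq> 0\<^sub>v n"
    proof
      assume "v = 0\<^sub>v n"
      then have "col ?V j = 0\<^sub>v n" using col[OF j(1)] j(2) by simp
      then have "(W * ?V) $$ (j, j) = 0" using W V len j(1) by simp
      then show False using j(1) WV by simp
    qed
    then show ?thesis using v M by (simp add: eigenvector_def)
  qed
  ultimately show ?thesis by blast
qed

section \<open>Promotion across the boundary of the first level\<close>

lemma promotion_step: "i < length w \<Longrightarrow> promotion r i w = promotion r (Suc i) (tau r i w)"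
  by (simp add: promotion_def upt_conv_Cons tau_def Let_def)

lemma promotion_trivial: "length w \<le> i \<Longrightarrow> promotion r i w = w"
  by (simp add: promotion_def)

lemma length_tau [simp]: "length (tau r i w) = length w"
  by (simp add: tau_def Let_def)

lemma set_tau: "i < length w \<Longrightarrow> set (tau r i w) = set w"
  by (simp add: tau_def Let_def set_swap)

lemma ladder_Cons: "ladder (Q # Qs) = Id_on (set Q) \<union> ladder Qs \<union> set Q \<times> set (concat Qs)"
proof -
  have "ladder (Q # Qs) = ordinal_sum (Id_on (set Q)) (ladder Qs)" by (simp add: ladder_def)
  then show ?thesis by (simp add: ordinal_sum_def Field_Id_on Field_ladder)
qed

lemma ladder_subset: "(a, b) \<in> ladder Qs \<Longrightarrow> a \<in> set (concat Qs) \<and> b \<in> set (concat Qs)"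
  by (metis FieldI1 FieldI2 Field_ladder)

text \<open>For \<open>1 \<le> i\<close> every swap that remains compares two letters of
  \<open>w\<close>, and on those letters the order of the whole ladder agrees with that of the upper
  levels. The induction is on the number of swaps still to be made.\<close>

lemma promotion_ladder_append:
  assumes disj: "set Q \<inter> set (concat Qs) = {}"
  shows "set w \<subseteq> set (concat Qs) \<Longrightarrow> 1 \<le> i \<Longrightarrow>
    promotion (ladder (Q # Qs)) (length p + i) (p @ w) = p @ promotion (ladder Qs) i w"
proof (induction "length w - i" arbitrary: i w)
  case 0
  then show ?case by (simp add: promotion_trivial)
next
  case (Suc k)
  have i: "i < length w" using Suc.hyps(2) by simp
  let ?r = "ladder (Q # Qs)" and ?s = "ladder Qs"
  have "w ! (i - 1) \<in> set w" "w ! i \<in> set w" using i by auto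
  then have "w ! (i - 1) \<notin> set Q" "w ! i \<notin> set Q" using Suc.prems disj by auto
  then have rel: "(w ! (i - 1), w ! i) \<in> ?r \<longleftrightarrow> (w ! (i - 1), w ! i) \<in> ?s"
      "(w ! i, w ! (i - 1)) \<in> ?r \<longleftrightarrow> (w ! i, w ! (i - 1)) \<in> ?s"
    unfolding ladder_Cons by auto
  have nth: "(p @ w) ! (length p + i - 1) = w ! (i - 1)" "(p @ w) ! (length p + i) = w ! i"
    using Suc.prems(2) by (auto simp: nth_append)
  obtain j where j: "i = Suc j" using Suc.prems(2) by (cases i) auto
  have tau: "tau ?r (length p + i) (p @ w) = p @ tau ?s i w"
    unfolding tau_def nth Let_def rel using j i by (simp add: list_update_append)
  have "promotion ?r (length p + i) (p @ w) = promotion ?r (length p + Suc i) (p @ tau ?s i w)"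
    using i tau by (simp add: promotion_step)
  also have "\<dots> = p @ promotion ?s (Suc i) (tau ?s i w)"
    using Suc.hyps Suc.prems i set_tau[OF i, of ?s] by (intro Suc.hyps(1)) auto
  finally show ?case using i by (simp add: promotion_step)
qed

text \<open>The last letter of \<open>p\<close> lies below the first letter of \<open>w\<close>, so
  the swap at the boundary does nothing. The promotion then goes on in \<open>w\<close> from its
  first position; this is where the matrix \<open>T\<close> of the upper levels comes from.\<close>

lemma promotion_ladder_boundary:
  assumes disj: "set Q \<inter> set (concat Qs) = {}"
    and w: "set w \<subseteq> set (concat Qs)" and p: "p \<noteq> []" "set p \<subseteq> set Q"
  shows "promotion (ladder (Q # Qs)) (length p) (p @ w) = p @ promotion (ladder Qs) 1 w"
proof (cases w)
  case Nil
  then show ?thesis by (simp add: promotion_trivial)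
next
  case (Cons h t)
  have "last p \<in> set Q" using p last_in_set by blast
  then have "(last p, h) \<in> ladder (Q # Qs)" using w Cons by (auto simp: ladder_Cons)
  moreover have "(p @ w) ! (length p - 1) = last p" "(p @ w) ! length p = h"
    using p Cons by (auto simp: nth_append last_conv_nth)
  ultimately have "tau (ladder (Q # Qs)) (length p) (p @ w) = p @ w"
    by (simp add: tau_def)
  then have "promotion (ladder (Q # Qs)) (length p) (p @ w)
      = promotion (ladder (Q # Qs)) (length p + 1) (p @ w)"
    using Cons by (subst promotion_step) auto
  then show ?thesis using promotion_ladder_append[OF disj w, of 1 p] by simp
qed

lemma smult_mat_mult_mat_vec:
  "dim_vec v = dim_col A \<Longrightarrow> (k \<cdot>\<^sub>m A) *\<^sub>v v = k \<cdot>\<^sub>v (A *\<^sub>v (v :: 'a :: comm_ring vec))"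
  by (rule eq_vecI) (auto simp: scalar_prod_def sum_distrib_left mult.assoc)

section \<open>Entries of the matrices \<open>T\<close> and \<open>M + c T\<close>\<close>

definition promotion_indicator :: "'a rel \<Rightarrow> 'a list \<Rightarrow> 'a list \<Rightarrow> real" where
  "promotion_indicator r u u' = of_bool (promotion r 1 u = u')"

text \<open>An entry of \<open>M + c T\<close>. The sum runs over all positions, with the condition
  as a 0/1 factor, so that it can be split at a level boundary.\<close>

definition step_weight :: "'a rel \<Rightarrow> ('a \<Rightarrow> real) \<Rightarrow> real \<Rightarrow> 'a list \<Rightarrow> 'a list \<Rightarrow> real" where
  "step_weight r x c u u' =
     (\<Sum>i=1..length u. of_bool (promotion r i u = u') * x (u ! (i - 1)))
     + c * promotion_indicator r u u'"

lemma step_weight_shift: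
  "step_weight r x c u u' = step_weight r x 0 u u' + c * promotion_indicator r u u'"
  by (simp add: step_weight_def)

text \<open>Promotions that start after the first level leave \<open>p\<close> unchanged, so they
  contribute to the diagonal blocks only, and there they reproduce the matrix of the upper levels.
  The one or two promotions that start inside the first level are left to be evaluated.\<close>

lemma step_weight_append:
  assumes disj: "set Q \<inter> set (concat Qs) = {}"
    and w: "set w \<subseteq> set (concat Qs)" and len: "length p = length p'"
  shows "step_weight (ladder (Q # Qs)) x c (p @ w) (p' @ w') =
    (\<Sum>i=1..length p. of_bool (promotion (ladder (Q # Qs)) i (p @ w) = p' @ w') * x (p ! (i - 1)))
    + of_bool (p = p') * step_weight (ladder Qs) x 0 w w'
    + c * promotion_indicator (ladder (Q # Qs)) (p @ w) (p' @ w')"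
proof -
  let ?f = "\<lambda>i. of_bool (promotion (ladder (Q # Qs)) i (p @ w) = p' @ w') * x ((p @ w) ! (i - 1))"
  have "sum ?f {1..length (p @ w)} = sum ?f {1..length p} + sum ?f {length p + 1..length p + length w}"
    unfolding length_append by (rule sum.ub_add_nat) simp
  also have "sum ?f {1..length p}
      = (\<Sum>i=1..length p. of_bool (promotion (ladder (Q # Qs)) i (p @ w) = p' @ w') * x (p ! (i - 1)))"
    by (intro sum.cong) (auto simp: nth_append)
  also have "sum ?f {length p + 1..length p + length w} = (\<Sum>i=1..length w. ?f (i + length p))"
    using sum.shift_bounds_cl_nat_ivl[of ?f 1 "length p" "length w"] by (simp add: add.commute)
  also have "\<dots> = (\<Sum>i=1..length w.
      of_bool (p = p') * (of_bool (promotion (ladder Qs) i w = w') * x (w ! (i - 1))))"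
  proof (intro sum.cong refl)
    fix i assume i: "i \<in> {1..length w}"
    have "promotion (ladder (Q # Qs)) (i + length p) (p @ w) = p @ promotion (ladder Qs) i w"
      using promotion_ladder_append[OF disj w, of i p] i by (simp add: add.commute)
    moreover have "(p @ w) ! (i + length p - 1) = w ! (i - 1)"
      using i by (auto simp: nth_append)
    ultimately show "?f (i + length p)
        = of_bool (p = p') * (of_bool (promotion (ladder Qs) i w = w') * x (w ! (i - 1)))"
      using len by simp
  qed
  also have "\<dots> = of_bool (p = p') * step_weight (ladder Qs) x 0 w w'"
    by (simp add: step_weight_def sum_distrib_left)
  finally show ?thesis by (simp add: step_weight_def)
qed

text \<open>The promotion that starts at \<open>a\<close> is stopped at once and triggers the first
  promotion of \<open>w\<close>, with weight \<open>x a\<close>. The added term \<open>c\<close>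
  refers to this same promotion, so the two weights merge.\<close>

lemma step_weight_singleton_level:
  assumes disj: "set [a] \<inter> set (concat Qs) = {}" and w: "set w \<subseteq> set (concat Qs)"
  shows "step_weight (ladder ([a] # Qs)) x c ([a] @ w) ([a] @ w')
    = step_weight (ladder Qs) x (c + x a) w w'"
proof -
  have "promotion (ladder ([a] # Qs)) 1 ([a] @ w) = [a] @ promotion (ladder Qs) 1 w"
    using promotion_ladder_boundary[OF disj w, of "[a]"] by simp
  then show ?thesis
    unfolding step_weight_append[OF disj w refl] step_weight_shift[of "ladder Qs" x "c + x a"]
    by (simp add: promotion_indicator_def algebra_simps)
qed

text \<open>The first promotion swaps the pair, with weight \<open>x a\<close> plus the added
  \<open>c\<close>; the second keeps the pair, with weight \<open>x b\<close>. Both go on with the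
  first promotion of \<open>w\<close>. Admitting both forms of \<open>Q\<close> lets the row of the
  ordering \<open>[b, a]\<close> follow by exchanging the letters.\<close>

lemma step_weight_pair_level:
  assumes Q: "Q = [a, b] \<or> Q = [b, a]" and ab: "a \<noteq> b"
    and disj: "set Q \<inter> set (concat Qs) = {}" and w: "set w \<subseteq> set (concat Qs)"
  shows "step_weight (ladder (Q # Qs)) x c ([a, b] @ w) ([a, b] @ w')
      = step_weight (ladder Qs) x (x b) w w'"
    and "step_weight (ladder (Q # Qs)) x c ([a, b] @ w) ([b, a] @ w')
      = (c + x a) * promotion_indicator (ladder Qs) w w'"
proof -
  let ?r = "ladder (Q # Qs)"
  have two: "promotion ?r 2 ([a, b] @ w) = [a, b] @ promotion (ladder Qs) 1 w"
    "promotion ?r 2 ([b, a] @ w) = [b, a] @ promotion (ladder Qs) 1 w"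
    using promotion_ladder_boundary[OF disj w, of "[a, b]"]
      promotion_ladder_boundary[OF disj w, of "[b, a]"] Q by (auto simp: numeral_2_eq_2)
  have "(a, b) \<notin> ?r" "(b, a) \<notin> ?r"
    using Q ab disj unfolding ladder_Cons by (auto dest: ladder_subset)
  then have "tau ?r 1 ([a, b] @ w) = [b, a] @ w" by (simp add: tau_def)
  then have one: "promotion ?r 1 ([a, b] @ w) = [b, a] @ promotion (ladder Qs) 1 w"
    using two(2) by (subst promotion_step) (auto simp: numeral_2_eq_2)
  have sum2: "(\<Sum>i=1..length [a, b]. f i) = f 1 + f 2" for f :: "nat \<Rightarrow> real"
    by (simp add: numeral_2_eq_2)
  show "step_weight ?r x c ([a, b] @ w) ([a, b] @ w') = step_weight (ladder Qs) x (x b) w w'"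
    using ab unfolding step_weight_append[OF disj w refl] step_weight_shift[of "ladder Qs" x "x b"]
      sum2 promotion_indicator_def one two by simp
  have len: "length [a, b] = length [b, a]" by simp
  show "step_weight ?r x c ([a, b] @ w) ([b, a] @ w')
      = (c + x a) * promotion_indicator (ladder Qs) w w'"
    using ab unfolding step_weight_append[OF disj w len]
      sum2 promotion_indicator_def one two by (simp add: algebra_simps)
qed

section \<open>The matrices \<open>M + c T\<close> and their block form\<close>

definition transition_mat :: "'a rel \<Rightarrow> ('a \<Rightarrow> real) \<Rightarrow> real \<Rightarrow> 'a list list \<Rightarrow> real mat" where
  "transition_mat r x c es = mat (length es) (length es) (\<lambda>(i, j). step_weight r x c (es ! i) (es ! j))"

definition indicator_mat :: "'a rel \<Rightarrow> 'a list list \<Rightarrow> real mat" where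
  "indicator_mat r es = mat (length es) (length es) (\<lambda>(i, j). promotion_indicator r (es ! i) (es ! j))"

lemma transition_mat_carrier [simp]: "transition_mat r x c es \<in> carrier_mat (length es) (length es)"
  by (simp add: transition_mat_def)

lemma indicator_mat_carrier [simp]: "indicator_mat r es \<in> carrier_mat (length es) (length es)"
  by (simp add: indicator_mat_def)

lemma transition_mat_shift:
  "transition_mat r x c es = transition_mat r x 0 es + c \<cdot>\<^sub>m indicator_mat r es"
  by (rule eq_matI) (auto simp: transition_mat_def indicator_mat_def step_weight_shift[of r x c])

lemma promotion_matrix_eq_transition_mat: "promotion_matrix r x es = transition_mat r x 0 es"
proof -
  have "(\<Sum>i\<in>{i \<in> {1..length u}. promotion r i u = u'}. x (u ! (i - 1))) = step_weight r x 0 u u'"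
    for u u'
  proof -
    have "(\<Sum>i\<in>{i \<in> {1..length u}. promotion r i u = u'}. x (u ! (i - 1)))
        = (\<Sum>i=1..length u. if promotion r i u = u' then x (u ! (i - 1)) else 0)"
      by (rule sum.inter_filter) simp
    also have "\<dots> = step_weight r x 0 u u'"
      unfolding step_weight_def by (simp only: mult_zero_left add_0_right, intro sum.cong) auto
    finally show ?thesis .
  qed
  then show ?thesis by (simp add: promotion_matrix_def transition_mat_def)
qed

lemma set_ladder_extension:
  assumes "\<forall>Q\<in>set Qs. length Q = 1 \<or> length Q = 2" "distinct (concat Qs)"
    and "w \<in> set (ladder_extensions Qs)"
  shows "set w = set (concat Qs)"
  using ladder_extensions_enumerate[OF assms(1,2)] assms(3)
  by (simp add: linear_extensions_def Field_ladder)

lemma transition_mat_singleton_level: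
  assumes "\<forall>Q\<in>set ([a] # Qs). length Q = 1 \<or> length Q = 2" "distinct (concat ([a] # Qs))"
  shows "transition_mat (ladder ([a] # Qs)) x c (ladder_extensions ([a] # Qs))
    = transition_mat (ladder Qs) x (c + x a) (ladder_extensions Qs)"
proof -
  have disj: "set [a] \<inter> set (concat Qs) = {}" using assms(2) by auto
  have "set (ladder_extensions Qs ! i) \<subseteq> set (concat Qs)" if "i < length (ladder_extensions Qs)" for i
    using set_ladder_extension[of Qs] assms that by simp
  note step_weight_singleton_level[OF disj this]
  then show ?thesis by (intro eq_matI) (auto simp: transition_mat_def)
qed

lemma transition_mat_pair_level:
  fixes x :: "'a \<Rightarrow> real"
  assumes "\<forall>Q\<in>set ([a, b] # Qs). length Q = 1 \<or> length Q = 2" "distinct (concat ([a, b] # Qs))"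
  defines "T \<equiv> indicator_mat (ladder Qs) (ladder_extensions Qs)"
    and "M \<equiv> \<lambda>d. transition_mat (ladder Qs) x d (ladder_extensions Qs)"
  shows "transition_mat (ladder ([a, b] # Qs)) x c (ladder_extensions ([a, b] # Qs))
    = four_block_mat (M (x b)) ((c + x a) \<cdot>\<^sub>m T) ((c + x b) \<cdot>\<^sub>m T) (M (x a))"
proof -
  let ?E = "ladder_extensions Qs" and ?Q = "[a, b]"
  have disj: "set ?Q \<inter> set (concat Qs) = {}" and ab: "a \<noteq> b" using assms(2) by auto
  have sub: "set (?E ! i) \<subseteq> set (concat Qs)" if "i < length ?E" for i
    using set_ladder_extension[of Qs] assms(1,2) that by simp
  \<comment> \<open>The next two instances give the upper and the lower block row:
    \<open>level_orderings\<close> puts the words that begin with \<open>a, b\<close> before those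
    that begin with \<open>b, a\<close>.\<close>
  note ab_rows = step_weight_pair_level[OF _ ab disj sub, simplified]
  note ba_rows = step_weight_pair_level[OF _ ab[symmetric] disj sub, simplified]
  show ?thesis
    unfolding M_def T_def
    by (intro eq_matI)
      (auto simp: transition_mat_def indicator_mat_def nth_append ab_rows ba_rows not_less)
qed

section \<open>Kronecker products, the recursion for the eigenpairs, and the matrix of
  eigenvectors\<close>

lemma kron_vec_one: "kron_vec (vec_of_list [1]) w = w"
  by (rule eq_vecI) (auto simp: kron_vec_def)

lemma kron_vec_pair:
  "kron_vec (vec_of_list [s, t]) w = (s \<cdot>\<^sub>v w) @\<^sub>v (t \<cdot>\<^sub>v w)"
proof (rule eq_vecI)
  fix i assume "i < dim_vec ((s \<cdot>\<^sub>v w) @\<^sub>v (t \<cdot>\<^sub>v w))"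
  then have i: "i < dim_vec w + dim_vec w" by simp
  have "i div dim_vec w = 1 \<and> i mod dim_vec w = i - dim_vec w" if "dim_vec w \<le> i"
    using that i by (auto simp: div_if mod_if le_div_geq)
  then show "kron_vec (vec_of_list [s, t]) w $ i = ((s \<cdot>\<^sub>v w) @\<^sub>v (t \<cdot>\<^sub>v w)) $ i"
    using i by (cases "i < dim_vec w") (auto simp: kron_vec_def)
qed (simp add: kron_vec_def)

lemma second_choice_vec:
  "vec_of_list [- x a, x b] - (c::real) \<cdot>\<^sub>v vec_of_list [1, - 1] = vec_of_list [- x a - c, x b + c]"
  by (rule eq_vecI) (auto simp: less_Suc_eq numeral_2_eq_2)

lemma ladder_eigenpairs_singleton_level:
  "ladder_eigenpairs x c ([a] # Qs) = ladder_eigenpairs x (c + x a) Qs"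
  by (simp add: kron_vec_one del: vec_of_list_Cons vec_of_list_Nil)

lemma ladder_eigenpairs_pair_level:
  "ladder_eigenpairs x c ([a, b] # Qs) =
    map (\<lambda>(e, w). (e, w @\<^sub>v w)) (ladder_eigenpairs x (c + x a + x b) Qs)
    @ map (\<lambda>(e, w). (e, ((- x a - c) \<cdot>\<^sub>v w) @\<^sub>v ((x b + c) \<cdot>\<^sub>v w))) (ladder_eigenpairs x (- c) Qs)"
  by (simp add: kron_vec_pair second_choice_vec del: vec_of_list_Cons vec_of_list_Nil)

text \<open>Both block rows of this matrix start with the matrix of \<open>us\<close>, so
  \<open>det_four_block_mat_same_left\<close> applies. At a pair level \<open>s = - x a - c\<close>
  and \<open>t = x b + c\<close>, hence \<open>t - s\<close> is the quantity that
  \<open>generic_weights\<close> keeps away from zero.\<close>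

lemma det_mat_of_cols_two_level:
  fixes us ws :: "'a :: idom vec list"
  assumes us: "length us = m" "set us \<subseteq> carrier_vec m" and ws: "length ws = m" "set ws \<subseteq> carrier_vec m"
  shows "det (mat_of_cols (m + m) (map (\<lambda>u. u @\<^sub>v u) us @ map (\<lambda>w. (s \<cdot>\<^sub>v w) @\<^sub>v (t \<cdot>\<^sub>v w)) ws))
    = det (mat_of_cols m us) * ((t - s) ^ m * det (mat_of_cols m ws))"
proof -
  let ?U = "mat_of_cols m us" and ?W = "mat_of_cols m ws"
  have U: "?U \<in> carrier_mat m m" and W: "?W \<in> carrier_mat m m"
    using us ws by (auto simp: mat_of_cols_def)
  have dim: "dim_vec (us ! i) = m" "dim_vec (ws ! i) = m" if "i < m" for i
  proof -
    have "us ! i \<in> carrier_vec m" "ws ! i \<in> carrier_vec m"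
      using us ws that nth_mem[of i us] nth_mem[of i ws] by (simp_all add: subset_iff)
    then show "dim_vec (us ! i) = m" "dim_vec (ws ! i) = m" by auto
  qed
  have "mat_of_cols (m + m) (map (\<lambda>u. u @\<^sub>v u) us @ map (\<lambda>w. (s \<cdot>\<^sub>v w) @\<^sub>v (t \<cdot>\<^sub>v w)) ws)
      = four_block_mat ?U (s \<cdot>\<^sub>m ?W) ?U (t \<cdot>\<^sub>m ?W)"
    using us(1) ws(1) by (intro eq_matI) (auto simp: mat_of_cols_index nth_append dim)
  moreover have "t \<cdot>\<^sub>m ?W - s \<cdot>\<^sub>m ?W = (t - s) \<cdot>\<^sub>m ?W"
    by (intro eq_matI) (auto simp: algebra_simps)
  ultimately show ?thesis
    using U W ws(1) by (simp add: det_four_block_mat_same_left[of _ m])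
qed

section \<open>Spectrum and eigenvectors by induction on the levels\<close>

lemma ladder_eigenpairs_transition_mat:
  fixes x :: "'a \<Rightarrow> real"
  assumes "\<forall>Q\<in>set Qs. length Q = 1 \<or> length Q = 2" "distinct (concat Qs)"
  shows "char_poly (transition_mat (ladder Qs) x c (ladder_extensions Qs))
      = (\<Prod>(e, v)\<leftarrow>ladder_eigenpairs x c Qs. [:- e, 1:])
    \<and> length (ladder_eigenpairs x c Qs) = length (ladder_extensions Qs)
    \<and> (\<forall>(e, v)\<in>set (ladder_eigenpairs x c Qs). v \<in> carrier_vec (length (ladder_extensions Qs))
        \<and> transition_mat (ladder Qs) x c (ladder_extensions Qs) *\<^sub>v v = e \<cdot>\<^sub>v v)
    \<and> (generic_weights x c Qs \<longrightarrow>
        det (mat_of_cols (length (ladder_extensions Qs)) (map snd (ladder_eigenpairs x c Qs))) \<noteq> 0)"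
  using assms
\<comment> \<open>The scalar is generalised because a pair level calls the hypothesis twice, with
  \<open>c + x a + x b\<close> and with \<open>- c\<close>.\<close>
proof (induction Qs arbitrary: c)
  case Nil
  let ?M = "transition_mat (ladder []) x c [[]]"
  \<comment> \<open>The only word is empty: its sum over positions vanishes and the promotion fixes
    it, so \<open>T\<close> is the 1 by 1 identity.\<close>
  have M: "?M = mat 1 1 (\<lambda>_. c)"
    by (intro eq_matI) (auto simp: transition_mat_def step_weight_def promotion_indicator_def
        promotion_trivial)
  have "char_poly ?M = (\<Prod>a\<leftarrow>diag_mat ?M. [:- a, 1:])"
    unfolding M by (rule char_poly_upper_triangular[of _ 1]) (auto simp: upper_triangular_def)
  then have "char_poly ?M = [:- c, 1:]" by (simp add: M diag_mat_def)
  moreover have "?M *\<^sub>v vec_of_list [1] = c \<cdot>\<^sub>v vec_of_list [1]"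
    unfolding M by (intro eq_vecI) (auto simp: scalar_prod_def)
  moreover have "mat_of_cols 1 [vec_of_list [1 :: real]] = 1\<^sub>m 1"
    by (intro eq_matI) (auto simp: mat_of_cols_index)
  then have "det (mat_of_cols 1 [vec_of_list [1 :: real]]) = 1" by simp
  ultimately show ?case
    by (simp del: vec_of_list_Cons vec_of_list_Nil) (simp add: carrier_dim_vec)
next
  case (Cons Q Qs)
  have lv: "\<forall>Q\<in>set Qs. length Q = 1 \<or> length Q = 2" "distinct (concat Qs)"
    using Cons.prems by simp_all
  have IH: "char_poly (transition_mat (ladder Qs) x d (ladder_extensions Qs))
        = (\<Prod>(e, v)\<leftarrow>ladder_eigenpairs x d Qs. [:- e, 1:])"
      "length (ladder_eigenpairs x d Qs) = length (ladder_extensions Qs)"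
      "\<And>e v. (e, v) \<in> set (ladder_eigenpairs x d Qs) \<Longrightarrow>
        v \<in> carrier_vec (length (ladder_extensions Qs))
        \<and> transition_mat (ladder Qs) x d (ladder_extensions Qs) *\<^sub>v v = e \<cdot>\<^sub>v v"
      "generic_weights x d Qs \<Longrightarrow>
        det (mat_of_cols (length (ladder_extensions Qs)) (map snd (ladder_eigenpairs x d Qs))) \<noteq> 0"
    for d
    using Cons.IH[OF lv, of d] by blast+
  from Cons.prems have "length Q = 1 \<or> length Q = 2" by simp
  then consider a where "Q = [a]" | a b where "Q = [a, b]"
    by (auto simp: length_Suc_conv numeral_2_eq_2)
  then show ?case
  proof cases
    case 1
    have "length (ladder_extensions (Q # Qs)) = length (ladder_extensions Qs)" using 1 by simp
    moreover have "generic_weights x (c + x a) Qs" if "generic_weights x c (Q # Qs)"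
      using that 1 by simp
    ultimately show ?thesis
      using IH transition_mat_singleton_level[of a Qs x c] Cons.prems
      unfolding 1 ladder_eigenpairs_singleton_level by auto
  next
    case 2
    define m where "m = length (ladder_extensions Qs)"
    define T where "T = indicator_mat (ladder Qs) (ladder_extensions Qs)"
    define M where "M d = transition_mat (ladder Qs) x d (ladder_extensions Qs)" for d
    define ps where "ps = ladder_eigenpairs x (c + x a + x b) Qs"
    define qs where "qs = ladder_eigenpairs x (- c) Qs"
    let ?G = "transition_mat (ladder (Q # Qs)) x c (ladder_extensions (Q # Qs))"
    have T: "T \<in> carrier_mat m m" and M: "\<And>d. M d \<in> carrier_mat m m"
      by (simp_all add: T_def M_def m_def)
    have len: "length (ladder_extensions (Q # Qs)) = m + m" by (simp add: 2 m_def)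
    have G: "?G = four_block_mat (M (x b)) ((c + x a) \<cdot>\<^sub>m T) ((c + x b) \<cdot>\<^sub>m T) (M (x a))"
      using transition_mat_pair_level[of a b Qs x c] Cons.prems unfolding 2 M_def T_def by simp
    have M_shift: "M d = M 0 + d \<cdot>\<^sub>m T" for d
      unfolding M_def T_def by (rule transition_mat_shift)
    \<comment> \<open>Since \<open>M d\<close> is affine in \<open>d\<close> with slope
      \<open>T\<close>, these three identities reduce to comparing coefficients of \<open>T\<close>.
      They supply the hypotheses and the two diagonal blocks for
      \<open>char_poly_four_block_mat_row_sums\<close>.\<close>
    have row1: "M (x b) + (c + x a) \<cdot>\<^sub>m T = M (c + x a + x b)"
      and row2: "(c + x b) \<cdot>\<^sub>m T + M (x a) = M (c + x a + x b)"
      and diff: "M (x a) - (c + x a) \<cdot>\<^sub>m T = M (- c)"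
      unfolding M_shift[of "x b"] M_shift[of "x a"] M_shift[of "c + x a + x b"] M_shift[of "- c"]
      using M[of 0] T by (intro eq_matI; auto simp: algebra_simps)+
    have pairs: "ladder_eigenpairs x c (Q # Qs) = map (\<lambda>(e, w). (e, w @\<^sub>v w)) ps
        @ map (\<lambda>(e, w). (e, ((- x a - c) \<cdot>\<^sub>v w) @\<^sub>v ((x b + c) \<cdot>\<^sub>v w))) qs"
      unfolding 2 ps_def qs_def by (rule ladder_eigenpairs_pair_level)
    have len_ps: "length ps = m" and len_qs: "length qs = m"
      by (simp_all add: ps_def qs_def m_def IH(2))
    have ps: "w \<in> carrier_vec m" "M (c + x a + x b) *\<^sub>v w = e \<cdot>\<^sub>v w" if "(e, w) \<in> set ps" for e w
      using IH(3) that by (auto simp: ps_def M_def m_def)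
    have qs: "w \<in> carrier_vec m" "M (- c) *\<^sub>v w = e \<cdot>\<^sub>v w" if "(e, w) \<in> set qs" for e w
      using IH(3) that by (auto simp: qs_def M_def m_def)
    have "char_poly ?G = char_poly (M (c + x a + x b)) * char_poly (M (- c))"
      unfolding G using char_poly_four_block_mat_row_sums[OF M _ _ M,
          of "(c + x a) \<cdot>\<^sub>m T" "(c + x b) \<cdot>\<^sub>m T" "x a" "x b"] T row1 row2 diff by simp
    also have "\<dots> = (\<Prod>(e, v)\<leftarrow>ps. [:- e, 1:]) * (\<Prod>(e, v)\<leftarrow>qs. [:- e, 1:])"
      unfolding M_def IH(1) ps_def qs_def ..
    also have "\<dots> = (\<Prod>(e, v)\<leftarrow>ladder_eigenpairs x c (Q # Qs). [:- e, 1:])"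
      unfolding pairs by (simp add: o_def case_prod_unfold)
    finally have char: "char_poly ?G = (\<Prod>(e, v)\<leftarrow>ladder_eigenpairs x c (Q # Qs). [:- e, 1:])" .
    have block_vec: "?G *\<^sub>v (u @\<^sub>v w) = (M (x b) *\<^sub>v u + ((c + x a) \<cdot>\<^sub>m T) *\<^sub>v w)
        @\<^sub>v (((c + x b) \<cdot>\<^sub>m T) *\<^sub>v u + M (x a) *\<^sub>v w)"
      if "u \<in> carrier_vec m" "w \<in> carrier_vec m" for u w
      unfolding G using four_block_mat_mult_vec[OF M _ _ M that] T by simp
    have eig1: "?G *\<^sub>v (w @\<^sub>v w) = e \<cdot>\<^sub>v (w @\<^sub>v w)" if ew: "(e, w) \<in> set ps" for e w
    proof -
      note w = ps[OF ew]
      have "M (x b) *\<^sub>v w + ((c + x a) \<cdot>\<^sub>m T) *\<^sub>v w = M (c + x a + x b) *\<^sub>v w"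
        "((c + x b) \<cdot>\<^sub>m T) *\<^sub>v w + M (x a) *\<^sub>v w = M (c + x a + x b) *\<^sub>v w"
        using add_mult_distrib_mat_vec[OF M _ w(1), of "(c + x a) \<cdot>\<^sub>m T" "x b"]
          add_mult_distrib_mat_vec[OF _ M w(1), of "(c + x b) \<cdot>\<^sub>m T" "x a"] T row1 row2
        by simp_all
      then have "?G *\<^sub>v (w @\<^sub>v w) = (M (c + x a + x b) *\<^sub>v w) @\<^sub>v (M (c + x a + x b) *\<^sub>v w)"
        using block_vec[OF w(1) w(1)] by simp
      also have "\<dots> = e \<cdot>\<^sub>v (w @\<^sub>v w)"
        unfolding w(2) by (intro eq_vecI) auto
      finally show ?thesis .
    qed
    \<comment> \<open>Up to sign, the coefficients of this vector are those of the off-diagonal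
      blocks. In each half the contributions of \<open>T\<close> therefore combine to
      \<open>M 0 - c T\<close>, that is \<open>M (- c)\<close>, applied to the same multiple of
      \<open>w\<close>.\<close>
    have eig2: "?G *\<^sub>v (((- x a - c) \<cdot>\<^sub>v w) @\<^sub>v ((x b + c) \<cdot>\<^sub>v w))
        = e \<cdot>\<^sub>v (((- x a - c) \<cdot>\<^sub>v w) @\<^sub>v ((x b + c) \<cdot>\<^sub>v w))" if ew: "(e, w) \<in> set qs" for e w
    proof -
      note w = qs[OF ew]
      \<comment> \<open>Through \<open>y\<close> and \<open>z\<close> every block product becomes a
        linear combination of two fixed vectors.\<close>
      define y where "y = M 0 *\<^sub>v w"
      define z where "z = T *\<^sub>v w"
      have yz: "y \<in> carrier_vec m" "z \<in> carrier_vec m"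
        using M[of 0] T w(1) by (auto simp: y_def z_def)
      have Mw: "M d *\<^sub>v w = y + d \<cdot>\<^sub>v z" for d
        unfolding M_shift[of d] y_def z_def using M[of 0] T w(1)
        by (subst add_mult_distrib_mat_vec[of _ m m]) (auto simp: smult_mat_mult_mat_vec)
      have Tw: "(d \<cdot>\<^sub>m T) *\<^sub>v w = d \<cdot>\<^sub>v z" for d
        unfolding z_def using T w(1) by (auto simp: smult_mat_mult_mat_vec)
      have eq: "y + (- c) \<cdot>\<^sub>v z = e \<cdot>\<^sub>v w" using w(2) Mw by simp
      have e: "e * w $ i = y $ i - c * z $ i" if "i < m" for i
        using arg_cong[OF eq, of "\<lambda>v. v $ i"] yz w(1) that by simp
      have "?G *\<^sub>v (((- x a - c) \<cdot>\<^sub>v w) @\<^sub>v ((x b + c) \<cdot>\<^sub>v w))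
        = ((- x a - c) \<cdot>\<^sub>v (y + x b \<cdot>\<^sub>v z) + (x b + c) \<cdot>\<^sub>v ((c + x a) \<cdot>\<^sub>v z))
          @\<^sub>v ((- x a - c) \<cdot>\<^sub>v ((c + x b) \<cdot>\<^sub>v z) + (x b + c) \<cdot>\<^sub>v (y + x a \<cdot>\<^sub>v z))"
        using w(1) M T by (subst block_vec) (auto simp: mult_mat_vec[of _ m m] Mw Tw)
      also have "\<dots> = e \<cdot>\<^sub>v (((- x a - c) \<cdot>\<^sub>v w) @\<^sub>v ((x b + c) \<cdot>\<^sub>v w))"
        \<comment> \<open>Commuting the eigenvalue next to the entry of \<open>w\<close> lets the
          entrywise equation \<open>e\<close> apply; \<open>less_diff_conv2\<close> handles the
          shifted index of the lower half.\<close>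
        using w(1) yz by (intro eq_vecI) (auto simp: mult.left_commute[of e] e less_diff_conv2 algebra_simps)
      finally show ?thesis .
    qed
    have eig: "\<forall>(e, v)\<in>set (ladder_eigenpairs x c (Q # Qs)).
        v \<in> carrier_vec (m + m) \<and> ?G *\<^sub>v v = e \<cdot>\<^sub>v v"
      using eig1 eig2 ps(1) qs(1) unfolding pairs by auto
    have det: "det (mat_of_cols (m + m) (map snd (ladder_eigenpairs x c (Q # Qs)))) \<noteq> 0"
      if gen: "generic_weights x c (Q # Qs)"
    proof -
      have nz: "x a + x b + 2 * c \<noteq> 0" and gen': "generic_weights x (c + x a + x b) Qs"
        "generic_weights x (- c) Qs" using gen by (simp_all add: 2)
      have snds: "map snd (ladder_eigenpairs x c (Q # Qs)) = map (\<lambda>u. u @\<^sub>v u) (map snd ps)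
          @ map (\<lambda>w. ((- x a - c) \<cdot>\<^sub>v w) @\<^sub>v ((x b + c) \<cdot>\<^sub>v w)) (map snd qs)"
        unfolding pairs by (simp add: o_def case_prod_unfold)
      have "det (mat_of_cols (m + m) (map snd (ladder_eigenpairs x c (Q # Qs))))
          = det (mat_of_cols m (map snd ps))
            * (((x b + c) - (- x a - c)) ^ m * det (mat_of_cols m (map snd qs)))"
        unfolding snds using len_ps len_qs ps(1) qs(1) by (intro det_mat_of_cols_two_level) auto
      moreover have "det (mat_of_cols m (map snd ps)) \<noteq> 0" "det (mat_of_cols m (map snd qs)) \<noteq> 0"
        using IH(4) gen' by (simp_all add: ps_def qs_def m_def)
      moreover have "(x b + c) - (- x a - c) \<noteq> 0" using nz by simp
      ultimately show ?thesis by simp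
    qed
    have "length (ladder_eigenpairs x c (Q # Qs)) = m + m"
      unfolding pairs using len_ps len_qs by simp
    then show ?thesis unfolding len using char eig det by (intro conjI impI)
  qed
qed

section \<open>Spectrum and diagonalization of the promotion matrix\<close>

theorem theorem9:
  fixes n :: nat and Qs :: "nat list list" and x :: "nat \<Rightarrow> real" and M :: "real mat"
    and ps :: "(real \<times> real vec) list"
  assumes "ladder_levels n Qs"
    and "\<forall>i\<in>{1..n}. 0 \<le> x i"
    and "(\<Sum>i=1..n. x i) = 1"
    and "M = promotion_matrix (ladder Qs) x (ladder_extensions Qs)"
    and "ps = ladder_eigenpairs x 0 Qs"
  shows "{c. eigenvalue M c} = fst ` set ps
    \<and> char_poly M = (\<Prod>(c, v)\<leftarrow>ps. [:- c, 1:])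
    \<and> (\<forall>(c, v)\<in>set ps. v \<in> carrier_vec (dim_row M) \<and> M *\<^sub>v v = c \<cdot>\<^sub>v v)
    \<and> (generic_weights x 0 Qs \<longrightarrow>
         diagonalizable M
         \<and> (\<forall>(c, v)\<in>set ps. eigenvector M v c)
         \<and> length ps = dim_row M
         \<and> invertible_mat (mat_of_cols (dim_row M) (map snd ps)))"
proof -
  have M: "M = transition_mat (ladder Qs) x 0 (ladder_extensions Qs)"
    using assms(4) by (simp add: promotion_matrix_eq_transition_mat)
  have lv: "\<forall>Q\<in>set Qs. length Q = 1 \<or> length Q = 2" "distinct (concat Qs)"
    using assms(1) by (auto simp: ladder_levels_def)
  have carrier: "M \<in> carrier_mat (dim_row M) (dim_row M)" and dim: "dim_row M = length (ladder_extensions Qs)"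
    by (simp_all add: M transition_mat_def)
  note spectrum = ladder_eigenpairs_transition_mat[OF lv, of x 0, folded M assms(5) dim]
  have char: "char_poly M = (\<Prod>(c, v)\<leftarrow>ps. [:- c, 1:])" and len: "length ps = dim_row M"
    and eig: "\<forall>(c, v)\<in>set ps. v \<in> carrier_vec (dim_row M) \<and> M *\<^sub>v v = c \<cdot>\<^sub>v v"
    using spectrum by auto
  \<comment> \<open>The eigenvalues are read off as roots of the characteristic polynomial, because
    without genericity a vector of the procedure may be zero.\<close>
  have "eigenvalue M c \<longleftrightarrow> c \<in> fst ` set ps" for c
    unfolding eigenvalue_root_char_poly[OF carrier] char poly_prod_list_zero_iff by force
  then have "{c. eigenvalue M c} = fst ` set ps" by blast
  moreover have "diagonalizable M \<and> (\<forall>(c, v)\<in>set ps. eigenvector M v c)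
      \<and> invertible_mat (mat_of_cols (dim_row M) (map snd ps))" if "generic_weights x 0 Qs"
    using spectrum that by (intro eigenvectors_diagonalize[OF carrier len eig]) blast
  ultimately show ?thesis using char len eig by blast
qed

end
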